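(* In the setting described in the context, assume that for every $m\ge1$, every $x\in\mathcal X^{\mathbb N}$ and all $y,y'\in\mathcal Y$, $d(F_m(x;y),F_m(x;y'))\le\delta(y,y')$. Let $p\in(0,1)$ and assume that there exist positive constants $K_k$ such that, for every $k\in[1,n]$, $$\mathbb E\Big[\big(G_{\varepsilon_k}(\varepsilon_k)\big)^2\exp\big(\big(G_{\varepsilon_k}(\varepsilon_k)\big)^p\big)\Big]\le K_k.$$ Set $$K=\sum_{k=1}^n\Big(\frac{a_{n-k}(n-k)}{a_{n-1}(n-1)}\Big)^2K_k.$$ If $K\ge1$, then for either choice of sign and every $x\ge0$, $$\mathbb P(\pm S_n\ge x)\le2\exp\Big(\frac{-x^2}{2\big(K(a_{n-1}(n-1))^2+x^{2-p}(a_{n-1}(n-1))^p\big)}\Big).$$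
   Context: Let $(\mathcal X,d)$ and $(\mathcal Y,\delta)$ be complete separable metric spaces. Let $(\varepsilon_i)_{i\ge1}$ be independent (not necessarily identically distributed) $\mathcal Y$-valued random variables, with $P_{\varepsilon_k}$ the law of $\varepsilon_k$. Let $(X_i)_{i\le0}$ be a deterministic sequence in $\mathcal X$. For each $m\ge1$ let $F_m:\mathcal X^{\mathbb N}\times\mathcal Y\to\mathcal X$ be measurable, and define recursively $X_m=F_m((X_{m-i})_{i\ge1};\varepsilon_m)$ for $m\ge1$. Assume there are nonnegative numbers $a_i$, $i\ge1$, with $\sum_{i\ge1}a_i<1$, such that for all $m\ge1$ and all sequences $(x_{m-i})_{i\ge1},(x'_{m-i})_{i\ge1}$ in $\mathcal X$, $$\mathbb E\big[d\big(F_m((x_{m-i})_{i\ge1};\varepsilon_m),F_m((x'_{m-i})_{i\ge1};\varepsilon_m)\big)\big]\le\sum_{i=1}^\infty a_i\,d(x_{m-i},x'_{m-i}).$$ Fix $n\ge1$ and let $f:\mathcal X^n\to\mathbb R$ satisfy $|f(x_1,\ldots,x_n)-f(x'_1,\ldots,x'_n)|\le\sum_{i=1}^n d(x_i,x'_i)$. Put $S_n=f(X_1,\ldots,X_n)-\mathbb E[f(X_1,\ldots,X_n)]$. The numbers $a_k(k)$, $k\ge0$, are defined recursively by $a_0(0)=1$ and $a_k(k)=1+a_k+\sum_{l=1}^{k-1}a_l(l)\,a_{k-l}$ for $k\ge1$ (so $a_1(1)=1+a_1$). $G_{\varepsilon_k}(y)=\int\delta(y,y')\,P_{\varepsilon_k}(dy')$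 for $y\in\mathcal Y$. *)

theory Defs
  imports "HOL-Probability.Probability"
begin

text \<open>
  Pasts are indexed from 0: a sequence \<open>(x_{m-i})_{i \<ge> 1}\<close> is coded as a function \<open>nat \<Rightarrow> 'a\<close>
  whose value at \<open>j\<close> is \<open>x_{m-1-j}\<close>. Hence the weight of entry \<open>j\<close> is \<open>a (Suc j)\<close>; the
  coefficients \<open>a\<close> keep their original index, and \<open>a 0\<close> is never used.
\<close>

definition past :: "(int \<Rightarrow> 'a) \<Rightarrow> int \<Rightarrow> nat \<Rightarrow> 'a" where
  "past x m = (\<lambda>j. x (m - 1 - int j))"

text \<open>\<open>acum a k\<close> is the number written \<open>a_k(k)\<close>.\<close>

fun acum :: "(nat \<Rightarrow> real) \<Rightarrow> nat \<Rightarrow> real" where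
  "acum a 0 = 1"
| "acum a (Suc k) = 1 + a (Suc k) + (\<Sum>l\<in>{1..<Suc k}. acum a l * a (Suc k - l))"

text \<open>
  \<open>mean_dist P y\<close> is \<open>G_\<epsilon>(y)\<close> for \<open>P\<close> the law of \<open>\<epsilon>\<close>. It is \<open>ennreal\<close>-valued because the
  integral may diverge; a Bochner integral would then silently be 0.
\<close>

definition mean_dist :: "'b::metric_space measure \<Rightarrow> 'b \<Rightarrow> ennreal" where
  "mean_dist P y = (\<integral>\<^sup>+ y'. ennreal (dist y y') \<partial>P)"

text \<open>Power with a positive exponent and exponential on \<open>[0, \<infinity>]\<close>, with value \<open>\<infinity>\<close> at \<open>\<infinity>\<close>.\<close>

definition ennreal_powr :: "ennreal \<Rightarrow> real \<Rightarrow> ennreal" where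
  "ennreal_powr t p = (if t = \<infinity> then \<infinity> else ennreal (enn2real t powr p))"

definition ennreal_exp :: "ennreal \<Rightarrow> ennreal" where
  "ennreal_exp t = (if t = \<infinity> then \<infinity> else ennreal (exp (enn2real t)))"

end

theory Submission
  imports Defs
begin

text \<open>
  Writing \<open>A = a_{n-1}(n-1)\<close>, decompose \<open>S_n / A\<close> into the martingale differences \<open>d_k\<close> along the
  filtration of the innovations. The contraction and the Lipschitz assumption on \<open>F\<close> show, by backward
  recursion, that \<open>E[f(X_1, \<dots>, X_n) | \<epsilon>_1, \<dots>, \<epsilon>_k]\<close> is \<open>a_{n-k}(n-k)\<close>-Lipschitz in \<open>\<epsilon>_k\<close>, hence
  \<open>|d_k| \<le> c_k G(\<epsilon>_k)\<close> with \<open>c_k = a_{n-k}(n-k) / A \<le> 1\<close>.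
  For a level \<open>b\<close> and \<open>\<lambda> \<le> b powr (p - 1)\<close>, the part of \<open>exp (\<lambda> d_k)\<close> on \<open>d_k \<le> b\<close> is at most
  \<open>1 + \<lambda> d_k + \<lambda>\<^sup>2 c_k\<^sup>2 G\<^sup>2 exp (G powr p) / 2\<close>, so that the event where no difference exceeds \<open>b\<close> contributes
  at most \<open>exp (- \<lambda> x + \<lambda>\<^sup>2 K / 2)\<close>, while Markov's inequality bounds the probability that some
  difference exceeds \<open>b\<close> by \<open>K / (b\<^sup>2 exp (b powr p))\<close>. A suitable choice of \<open>\<lambda>\<close> and \<open>b\<close> makes
  each of the two terms at most half of the claimed bound.
\<close>

section \<open>Elementary inequalities\<close>

text \<open>The quadratic Taylor polynomials at \<open>t\<close> and at \<open>- t\<close> have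
  product \<open>1 + t ^ 4 / 4\<close>, which is at least 1. Hence the Taylor lower bound for
  \<open>exp (- t)\<close> inverts to an upper bound for \<open>exp t\<close>.\<close>

lemma exp_le_quadratic_nonpos:
  fixes t :: real
  assumes "t \<le> 0"
  shows "exp t \<le> 1 + t + t\<^sup>2 / 2"
proof -
  have "1 - t + t\<^sup>2 / 2 \<le> exp (- t)"
    using exp_lower_Taylor_quadratic[of "- t"] assms by simp
  moreover have "(1 - t + t\<^sup>2 / 2) * (1 + t + t\<^sup>2 / 2) = 1 + (t\<^sup>2)\<^sup>2 / 4"
    by (simp add: power2_eq_square field_simps)
  moreover have "0 < 1 + t + t\<^sup>2 / 2"
  proof -
    have "1 + t + t\<^sup>2 / 2 = ((1 + t)\<^sup>2 + 1) / 2"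
      by (simp add: power2_eq_square field_simps)
    moreover have "0 < ((1 + t)\<^sup>2 + 1) / 2"
      by (simp add: add_nonneg_pos)
    ultimately show ?thesis
      by (simp only:)
  qed
  ultimately have "1 \<le> exp (- t) * (1 + t + t\<^sup>2 / 2)"
    using mult_right_mono[of "1 - t + t\<^sup>2 / 2" "exp (- t)" "1 + t + t\<^sup>2 / 2"] zero_le_power2[of "t\<^sup>2"] by linarith
  then show ?thesis
    by (simp add: exp_minus field_simps)
qed

text \<open>Lagrange form of the remainder; its intermediate point is at most \<open>t\<close>, so
  the factor there is at most \<open>exp t\<close>.\<close>

lemma exp_le_quadratic_nonneg:
  fixes t :: real
  assumes "0 \<le> t"
  shows "exp t \<le> 1 + t + t\<^sup>2 / 2 * exp t"
proof -
  obtain s where s: "\<bar>s\<bar> \<le> \<bar>t\<bar>" "exp t = (\<Sum>m<2. t ^ m / fact m) + exp s / fact 2 * t ^ 2"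
    using Maclaurin_exp_le[of t 2] by blast
  have "exp s * t\<^sup>2 \<le> exp t * t\<^sup>2"
    using s(1) assms by (intro mult_right_mono) auto
  moreover have "exp t = 1 + t + exp s * t\<^sup>2 / 2"
    using s(2) by (simp add: numeral_2_eq_2)
  ultimately show ?thesis
    by (simp add: mult.commute)
qed

text \<open>For \<open>0 \<le> d \<le> y\<close> the choice \<open>\<lambda> \<le> y powr (p - 1)\<close> gives \<open>\<lambda> d \<le> d powr p\<close>, so the exponential
  moment of a truncated variable is controlled by the subexponential one.\<close>

lemma truncated_exp_le:
  fixes d g y l p :: real
  assumes l: "0 \<le> l" "l \<le> y powr (p - 1)" and y: "0 < y" and p: "0 < p" "p < 1"
    and dg: "\<bar>d\<bar> \<le> g"
  shows "(if d \<le> y then exp (l * d) else 0) \<le> 1 + l * d + l\<^sup>2 / 2 * (g\<^sup>2 * exp (g powr p))"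
proof -
  have sq: "d\<^sup>2 \<le> g\<^sup>2"
    using power_mono[OF dg, of 2] by simp
  have g1: "d\<^sup>2 * c \<le> g\<^sup>2 * exp (g powr p)" if "0 \<le> c" "c \<le> exp (g powr p)" for c
    using sq that by (intro mult_mono) auto
  have g2: "l\<^sup>2 / 2 * (d\<^sup>2 * c) \<le> l\<^sup>2 / 2 * (g\<^sup>2 * exp (g powr p))" if "0 \<le> c" "c \<le> exp (g powr p)" for c
    using g1[OF that] by (intro mult_left_mono) auto
  consider "d \<le> 0" | "0 < d" "d \<le> y" | "y < d"
    by linarith
  then show ?thesis
  proof cases
    case 1
    have "exp (l * d) \<le> 1 + l * d + (l * d)\<^sup>2 / 2"
      using 1 l by (intro exp_le_quadratic_nonpos) (simp add: mult_nonneg_nonpos)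
    also have "\<dots> \<le> 1 + l * d + l\<^sup>2 / 2 * (g\<^sup>2 * exp (g powr p))"
      using g2[of 1] by (simp add: power_mult_distrib)
    finally show ?thesis
      using 1 y by simp
  next
    case 2
    have "l * d \<le> y powr (p - 1) * d"
      using l 2 by (intro mult_right_mono) auto
    also have "\<dots> \<le> d powr (p - 1) * d"
      using 2 p by (intro mult_right_mono powr_mono2') auto
    also have "\<dots> = d powr p"
      using 2 by (simp add: powr_diff)
    also have "\<dots> \<le> g powr p"
      using 2 dg p by (intro powr_mono2) auto
    finally have ld: "exp (l * d) \<le> exp (g powr p)"
      by simp
    have "exp (l * d) \<le> 1 + l * d + (l * d)\<^sup>2 / 2 * exp (l * d)"
      using 2 l by (intro exp_le_quadratic_nonneg) simp
    also have "\<dots> \<le> 1 + l * d + l\<^sup>2 / 2 * (g\<^sup>2 * exp (g powr p))"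
      using g2[OF _ ld] by (simp add: power_mult_distrib mult.assoc)
    finally show ?thesis
      using 2 by simp
  next
    case 3
    have "0 \<le> l * d"
      using 3 l y by simp
    moreover have "0 \<le> l\<^sup>2 / 2 * (g\<^sup>2 * exp (g powr p))"
      by simp
    ultimately show ?thesis
      using 3 by simp
  qed
qed

text \<open>With \<open>L = max K (x powr (2 - p))\<close> the choice is \<open>\<lambda> = x / L\<close>, the minimiser of
  \<open>- \<lambda> x + \<lambda>\<^sup>2 L / 2\<close>, and \<open>y powr (1 - p) = L / x\<close>, the largest level admitting this \<open>\<lambda>\<close>.\<close>

lemma exists_truncation_level:
  fixes x K p :: real
  assumes x: "0 < x" and K: "1 \<le> K" and p: "0 < p" "p < 1"
  obtains l y where "0 \<le> l" "0 < y" "l \<le> y powr (p - 1)"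
    "exp (- l * x + l\<^sup>2 / 2 * K) \<le> exp (- x\<^sup>2 / (2 * (K + x powr (2 - p))))"
    "K / (y\<^sup>2 * exp (y powr p)) \<le> exp (- x\<^sup>2 / (2 * (K + x powr (2 - p))))"
proof -
  define L where "L = max K (x powr (2 - p))"
  define l where "l = x / L"
  define y where "y = (L / x) powr (1 / (1 - p))"
  have L: "1 \<le> L" "K \<le> L" "x powr (2 - p) \<le> L" "L \<le> K + x powr (2 - p)"
    using K by (auto simp: L_def)
  have y0: "0 < y"
    using L x by (auto simp: y_def)
  have yp: "y powr (1 - p) = L / x"
    using L x p by (simp add: y_def powr_powr)
  have yl: "y powr (p - 1) = l"
    using yp powr_minus[of y "1 - p"] by (simp add: l_def)
  \<comment> \<open>The second entry of the maximum gives \<open>L / x \<ge> x powr (1 - p)\<close>,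
    and \<open>y powr (1 - p) = L / x\<close>.\<close>
  have xy: "x \<le> y"
  proof (rule ccontr)
    assume "\<not> x \<le> y"
    then have "y powr (1 - p) < x powr (1 - p)"
      using y0 p by (intro powr_less_mono2) auto
    also have "\<dots> = x powr (2 - p) / x"
      using x by (simp add: powr_diff powr_add power2_eq_square)
    also have "\<dots> \<le> L / x"
      using L x by (intro divide_right_mono) auto
    finally show False
      using yp by simp
  qed
  have Lxy: "L = x * y powr (1 - p)"
    using yp x by simp
  \<comment> \<open>If \<open>y < 1\<close>, then also \<open>x < 1\<close>, and
    \<open>L = x * y powr (1 - p)\<close> would be below 1, against
    \<open>1 \<le> K \<le> L\<close>.\<close>
  have y1: "1 \<le> y"
  proof (rule ccontr)
    assume "\<not> 1 \<le> y"
    then have "x < 1" "y powr (1 - p) \<le> 1"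
      using xy y0 p by (auto intro!: powr_le1)
    then have "x * y powr (1 - p) < 1"
      using mult_left_le[of "y powr (1 - p)" x] x by linarith
    then show False
      using Lxy L by simp
  qed
  have tgt: "exp (- x\<^sup>2 / (2 * L)) \<le> exp (- x\<^sup>2 / (2 * (K + x powr (2 - p))))"
    using L x by (simp add: frac_le)
  have "- l * x + l\<^sup>2 / 2 * K \<le> - l * x + l\<^sup>2 / 2 * L"
    using L by (simp add: mult_left_mono)
  also have "\<dots> = - x\<^sup>2 / (2 * L)"
    using L by (simp add: l_def power2_eq_square field_simps)
  finally have "exp (- l * x + l\<^sup>2 / 2 * K) \<le> exp (- x\<^sup>2 / (2 * L))"
    by (simp only: exp_le_cancel_iff)
  then have 1: "exp (- l * x + l\<^sup>2 / 2 * K) \<le> exp (- x\<^sup>2 / (2 * (K + x powr (2 - p))))"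
    using tgt by (rule order_trans)
  \<comment> \<open>The bound \<open>K \<le> y^2\<close> derived here absorbs the factor
    \<open>K\<close> of the Markov term, so only the exponential is left to compare.\<close>
  have "L = x * (y * y powr (- p))"
    using Lxy y0 by (simp add: powr_diff powr_minus field_simps)
  also have "\<dots> \<le> y * (y * 1)"
    using xy x y1 powr_mono[of "- p" 0 y] p by (intro mult_mono) auto
  finally have "K \<le> y\<^sup>2"
    using L by (simp add: power2_eq_square)
  then have "K / (y\<^sup>2 * exp (y powr p)) \<le> 1 / exp (y powr p)"
    using y0 by (simp add: field_simps)
  also have "\<dots> = exp (- (y powr p))"
    by (simp add: exp_minus field_simps)
  also have "\<dots> \<le> exp (- x\<^sup>2 / (2 * L))"
  proof -
    have "x\<^sup>2 / L = x * y powr (p - 1)"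
      unfolding yl l_def by (simp add: power2_eq_square)
    also have "\<dots> \<le> y * y powr (p - 1)"
      using xy by (intro mult_right_mono) auto
    also have "\<dots> = y powr p"
      using y0 by (simp add: powr_diff)
    finally have "x\<^sup>2 / L \<le> y powr p" .
    moreover have "0 \<le> x\<^sup>2 / L" "- x\<^sup>2 / (2 * L) = - (x\<^sup>2 / L / 2)"
      using L by simp_all
    ultimately have "- (y powr p) \<le> - x\<^sup>2 / (2 * L)"
      by linarith
    then show ?thesis
      by simp
  qed
  also note tgt
  finally have 2: "K / (y\<^sup>2 * exp (y powr p)) \<le> exp (- x\<^sup>2 / (2 * (K + x powr (2 - p))))" .
  show thesis
    using that[of l y] 1 2 y0 yl L x by (simp add: l_def)
qed

section \<open>Martingale differences driven by independent innovations\<close>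

text \<open>Follows from \<open>g \<le> 1 + g^2\<close> and from the exponential factor being at
  least 1.\<close>

lemma (in prob_space) integrable_of_square_exp:
  fixes g :: "'a \<Rightarrow> real"
  assumes g [measurable]: "g \<in> borel_measurable M" and nonneg: "\<And>y. y \<in> space M \<Longrightarrow> 0 \<le> g y"
    and fin: "(\<integral>\<^sup>+ y. ennreal ((g y)\<^sup>2 * exp (g y powr p)) \<partial>M) < \<infinity>"
  shows "integrable M g"
proof (rule Bochner_Integration.integrable_bound)
  have "integrable M (\<lambda>y. (g y)\<^sup>2 * exp (g y powr p))"
    using fin by (intro integrableI_bounded) auto
  then show "integrable M (\<lambda>y. 1 + (g y)\<^sup>2 * exp (g y powr p))"
    by simp
  have "\<bar>g y\<bar> \<le> 1 + (g y)\<^sup>2 * exp (g y powr p)" if "y \<in> space M" for y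
  proof -
    have "2 * g y \<le> 1 + (g y)\<^sup>2"
      using zero_le_power2[of "g y - 1"] by (simp add: power2_eq_square algebra_simps)
    moreover have "(g y)\<^sup>2 * 1 \<le> (g y)\<^sup>2 * exp (g y powr p)"
      by (intro mult_left_mono) auto
    ultimately show ?thesis
      using nonneg[OF that] by auto
  qed
  then show "AE y in M. norm (g y) \<le> norm (1 + (g y)\<^sup>2 * exp (g y powr p))"
    by (auto intro!: AE_I2 order_trans[OF _ abs_ge_self])
qed measurable

section \<open>Independence of the history and the current innovation\<close>

locale innovations = prob_space M for M :: "'w measure" +
  fixes N :: "'b measure" and eps :: "nat \<Rightarrow> 'w \<Rightarrow> 'b"
  assumes indep: "indep_vars (\<lambda>_. N) eps {1..}"
begin

definition law :: "nat \<Rightarrow> 'b measure" where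
  "law m = distr M N (eps m)"

text \<open>Only innovations strictly before time \<open>m\<close> enter, so \<open>eps m\<close> is
  independent of them. The restriction makes the value a point of the finite product
  \<open>Hist m\<close>.\<close>

definition hist :: "nat \<Rightarrow> 'w \<Rightarrow> nat \<Rightarrow> 'b" where
  "hist m \<omega> = (\<lambda>i\<in>{0<..<m}. eps i \<omega>)"

abbreviation Hist :: "nat \<Rightarrow> (nat \<Rightarrow> 'b) measure" where
  "Hist m \<equiv> Pi\<^sub>M {0<..<m} (\<lambda>_. N)"

lemma sets_law [simp, measurable_cong]: "sets (law m) = sets N"
  by (simp add: law_def)

lemma space_law [simp]: "space (law m) = space N"
  by (simp add: law_def)

lemma measurable_eps: "1 \<le> m \<Longrightarrow> eps m \<in> measurable M N"
  using indep by (auto simp: indep_vars_def)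

lemma measurable_hist [measurable]: "hist m \<in> measurable M (Hist m)"
  unfolding hist_def by (intro measurable_restrict measurable_eps) auto

lemma prob_space_law: "1 \<le> m \<Longrightarrow> prob_space (law m)"
  unfolding law_def by (intro prob_space_distr measurable_eps)

lemma hist_in_space: "\<omega> \<in> space M \<Longrightarrow> hist m \<omega> \<in> space (Hist m)"
  using measurable_hist by (rule measurable_space)

text \<open>Grouping over the disjoint index sets \<open>{0<..<m}\<close> and \<open>{m}\<close>
  gives independence from a function on a singleton; evaluating that function at \<open>m\<close>
  turns it into the innovation itself.\<close>

lemma distr_hist_eps:
  assumes m: "1 \<le> m"
  shows "distr M (Hist m \<Otimes>\<^sub>M N) (\<lambda>\<omega>. (hist m \<omega>, eps m \<omega>)) = distr M (Hist m) (hist m) \<Otimes>\<^sub>M law m"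
proof -
  let ?Q = "Pi\<^sub>M {m} (\<lambda>_. N)" and ?e = "\<lambda>\<omega>. \<lambda>i\<in>{m}. eps i \<omega>"
  note [measurable] = measurable_eps[OF m]
  have e [measurable]: "?e \<in> measurable M ?Q"
    by (intro measurable_restrict) simp
  have ev [measurable]: "(\<lambda>e. e m) \<in> measurable ?Q N"
    by simp
  have "indep_var (Hist m) (\<lambda>\<omega>. restrict (\<lambda>i. eps i \<omega>) {0<..<m}) ?Q ?e"
    using m by (intro indep_var_restrict[OF indep]) auto
  then have prod: "distr M (Hist m) (hist m) \<Otimes>\<^sub>M distr M ?Q ?e
      = distr M (Hist m \<Otimes>\<^sub>M ?Q) (\<lambda>\<omega>. (hist m \<omega>, ?e \<omega>))"
    by (simp add: indep_var_distribution_eq hist_def[abs_def])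
  have law: "distr (distr M ?Q ?e) N (\<lambda>e. e m) = law m"
    by (simp add: distr_distr law_def comp_def)
  have "distr M (Hist m) (hist m) \<Otimes>\<^sub>M law m
      = distr (distr M (Hist m) (hist m)) (Hist m) (\<lambda>e. e) \<Otimes>\<^sub>M distr (distr M ?Q ?e) N (\<lambda>e. e m)"
    by (simp add: law distr_id2)
  also have "\<dots> = distr (distr M (Hist m) (hist m) \<Otimes>\<^sub>M distr M ?Q ?e) (Hist m \<Otimes>\<^sub>M N) (\<lambda>(e, e'). (e, e' m))"
    using prob_space_law[OF m] law
    by (intro pair_measure_distr) (auto intro: prob_space_imp_sigma_finite)
  also have "\<dots> = distr M (Hist m \<Otimes>\<^sub>M N) (\<lambda>\<omega>. (hist m \<omega>, eps m \<omega>))"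
    unfolding prod by (subst distr_distr) (auto simp: comp_def)
  finally show ?thesis
    by simp
qed

text \<open>Tonelli on the product law. Integrating out \<open>eps m\<close> with the history frozen
  plays the role of a conditional expectation.\<close>

lemma nn_integral_hist_eps:
  assumes m: "1 \<le> m" and g [measurable]: "(\<lambda>(e, y). g e y) \<in> borel_measurable (Hist m \<Otimes>\<^sub>M N)"
  shows "(\<integral>\<^sup>+ \<omega>. g (hist m \<omega>) (eps m \<omega>) \<partial>M) = (\<integral>\<^sup>+ \<omega>. \<integral>\<^sup>+ y. g (hist m \<omega>) y \<partial>law m \<partial>M)"
proof -
  note [measurable] = measurable_eps[OF m]
  interpret law: prob_space "law m"
    by (rule prob_space_law[OF m])
  have "(\<integral>\<^sup>+ \<omega>. g (hist m \<omega>) (eps m \<omega>) \<partial>M)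
      = (\<integral>\<^sup>+ z. (\<lambda>(e, y). g e y) z \<partial>distr M (Hist m \<Otimes>\<^sub>M N) (\<lambda>\<omega>. (hist m \<omega>, eps m \<omega>)))"
    by (subst nn_integral_distr) auto
  also have "\<dots> = (\<integral>\<^sup>+ e. \<integral>\<^sup>+ y. g e y \<partial>law m \<partial>distr M (Hist m) (hist m))"
    unfolding distr_hist_eps[OF m] by (subst law.nn_integral_fst[symmetric]) auto
  also have "\<dots> = (\<integral>\<^sup>+ \<omega>. \<integral>\<^sup>+ y. g (hist m \<omega>) y \<partial>law m \<partial>M)"
    by (subst nn_integral_distr) auto
  finally show ?thesis .
qed

text \<open>The martingale difference property, by Fubini; integrability is asked for because
  \<open>g\<close> may change sign.\<close>

lemma expectation_hist_eps_eq_0: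
  fixes g :: "(nat \<Rightarrow> 'b) \<Rightarrow> 'b \<Rightarrow> real"
  assumes m: "1 \<le> m" and g [measurable]: "(\<lambda>(e, y). g e y) \<in> borel_measurable (Hist m \<Otimes>\<^sub>M N)"
    and int: "integrable M (\<lambda>\<omega>. g (hist m \<omega>) (eps m \<omega>))"
    and zero: "\<And>e. e \<in> space (Hist m) \<Longrightarrow> (\<integral>y. g e y \<partial>law m) = 0"
  shows "expectation (\<lambda>\<omega>. g (hist m \<omega>) (eps m \<omega>)) = 0"
proof -
  note [measurable] = measurable_eps[OF m]
  interpret law: prob_space "law m"
    by (rule prob_space_law[OF m])
  interpret H: prob_space "distr M (Hist m) (hist m)"
    by (intro prob_space_distr) measurable
  interpret P: pair_sigma_finite "distr M (Hist m) (hist m)" "law m" ..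
  let ?J = "distr M (Hist m \<Otimes>\<^sub>M N) (\<lambda>\<omega>. (hist m \<omega>, eps m \<omega>))"
  have "integrable ?J (\<lambda>(e, y). g e y)"
    using int by (subst integrable_distr_eq) auto
  then have I: "integrable (distr M (Hist m) (hist m) \<Otimes>\<^sub>M law m) (\<lambda>(e, y). g e y)"
    unfolding distr_hist_eps[OF m] .
  have "expectation (\<lambda>\<omega>. g (hist m \<omega>) (eps m \<omega>)) = (\<integral>z. (\<lambda>(e, y). g e y) z \<partial>?J)"
    by (subst integral_distr) auto
  also have "\<dots> = (\<integral>e. \<integral>y. g e y \<partial>law m \<partial>distr M (Hist m) (hist m))"
    unfolding distr_hist_eps[OF m] using P.integral_fst'[OF I] by simp
  also have "\<dots> = (\<integral>e. 0 \<partial>distr M (Hist m) (hist m))"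
    by (intro Bochner_Integration.integral_cong) (auto simp: zero)
  finally show ?thesis
    by simp
qed

section \<open>Exponential moments and the deviation bound\<close>

text \<open>The last factor is integrated out first: given the history it contributes at most its
  constant, uniformly, and the remaining product is handled by induction.\<close>

lemma nn_integral_prod_le:
  fixes h :: "nat \<Rightarrow> (nat \<Rightarrow> 'b) \<Rightarrow> 'b \<Rightarrow> ennreal"
  assumes h: "\<And>m. m \<in> {1..n} \<Longrightarrow> (\<lambda>(e, y). h m e y) \<in> borel_measurable (Hist m \<Otimes>\<^sub>M N)"
    and bound: "\<And>m e. m \<in> {1..n} \<Longrightarrow> e \<in> space (Hist m) \<Longrightarrow> (\<integral>\<^sup>+ y. h m e y \<partial>law m) \<le> C m"
  shows "(\<integral>\<^sup>+ \<omega>. (\<Prod>m=1..n. h m (hist m \<omega>) (eps m \<omega>)) \<partial>M) \<le> (\<Prod>m=1..n. C m)"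
  using assms
proof (induction n)
  case 0
  then show ?case
    by (simp add: emeasure_space_1)
next
  case (Suc k)
  \<comment> \<open>The earlier factors, written as a function of the history before time
    \<open>k + 1\<close>, so that they are frozen when the last innovation is integrated
    out.\<close>
  define Z where "Z e = (\<Prod>m=1..k. h m (restrict e {0<..<m}) (e m))" for e
  have Z_hist: "Z (hist (Suc k) \<omega>) = (\<Prod>m=1..k. h m (hist m \<omega>) (eps m \<omega>))" for \<omega>
    unfolding Z_def by (intro prod.cong refl arg_cong2[where f="h _"]) (auto simp: hist_def fun_eq_iff)
  have [measurable]: "Z \<in> borel_measurable (Hist (Suc k))"
    unfolding Z_def
  proof (intro borel_measurable_prod_ennreal)
    fix m assume m: "m \<in> {1..k}"
    then have [measurable]: "(\<lambda>(e, y). h m e y) \<in> borel_measurable (Hist m \<Otimes>\<^sub>M N)"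
      using Suc.prems(1) by simp
    have [measurable]: "(\<lambda>e. restrict e {0<..<m}) \<in> measurable (Hist (Suc k)) (Hist m)"
      using m by (intro measurable_restrict_subset) auto
    have [measurable]: "(\<lambda>e. e m) \<in> measurable (Hist (Suc k)) N"
      using m by (intro measurable_component_singleton) auto
    show "(\<lambda>e. h m (restrict e {0<..<m}) (e m)) \<in> borel_measurable (Hist (Suc k))"
      by measurable
  qed
  have [measurable]: "(\<lambda>(e, y). h (Suc k) e y) \<in> borel_measurable (Hist (Suc k) \<Otimes>\<^sub>M N)"
    using Suc.prems(1) by simp
  have "(\<integral>\<^sup>+ \<omega>. (\<Prod>m=1..Suc k. h m (hist m \<omega>) (eps m \<omega>)) \<partial>M)
      = (\<integral>\<^sup>+ \<omega>. Z (hist (Suc k) \<omega>) * h (Suc k) (hist (Suc k) \<omega>) (eps (Suc k) \<omega>) \<partial>M)"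
    by (simp add: Z_hist)
  also have "\<dots> = (\<integral>\<^sup>+ \<omega>. \<integral>\<^sup>+ y. Z (hist (Suc k) \<omega>) * h (Suc k) (hist (Suc k) \<omega>) y \<partial>law (Suc k) \<partial>M)"
    by (intro nn_integral_hist_eps[where g="\<lambda>e y. Z e * h (Suc k) e y"]) auto
  also have "\<dots> \<le> (\<integral>\<^sup>+ \<omega>. Z (hist (Suc k) \<omega>) * C (Suc k) \<partial>M)"
  proof (intro nn_integral_mono)
    fix \<omega> assume \<omega>: "\<omega> \<in> space M"
    note hs = hist_in_space[OF \<omega>, of "Suc k"]
    have [measurable]: "h (Suc k) (hist (Suc k) \<omega>) \<in> borel_measurable N"
      using hs by measurable
    have "(\<integral>\<^sup>+ y. Z (hist (Suc k) \<omega>) * h (Suc k) (hist (Suc k) \<omega>) y \<partial>law (Suc k))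
        = Z (hist (Suc k) \<omega>) * (\<integral>\<^sup>+ y. h (Suc k) (hist (Suc k) \<omega>) y \<partial>law (Suc k))"
      by (intro nn_integral_cmult) measurable
    also have "\<dots> \<le> Z (hist (Suc k) \<omega>) * C (Suc k)"
      using Suc.prems(2)[of "Suc k"] hs by (intro mult_left_mono) auto
    finally show "(\<integral>\<^sup>+ y. Z (hist (Suc k) \<omega>) * h (Suc k) (hist (Suc k) \<omega>) y \<partial>law (Suc k))
        \<le> Z (hist (Suc k) \<omega>) * C (Suc k)" .
  qed
  also have "\<dots> = (\<integral>\<^sup>+ \<omega>. Z (hist (Suc k) \<omega>) \<partial>M) * C (Suc k)"
    by (intro nn_integral_multc) measurable
  also have "\<dots> \<le> (\<Prod>m=1..k. C m) * C (Suc k)"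
    unfolding Z_hist using Suc.prems by (intro mult_right_mono Suc.IH) auto
  finally show ?case
    by simp
qed

text \<open>Large differences are split off at the level \<open>b\<close>. The remaining event is
  treated by an exponential Markov bound with parameter \<open>l\<close>, the large differences by a
  union bound.\<close>

lemma subexponential_deviation:
  fixes D :: "nat \<Rightarrow> (nat \<Rightarrow> 'b) \<Rightarrow> 'b \<Rightarrow> real" and G :: "nat \<Rightarrow> 'b \<Rightarrow> real"
    and c Kc :: "nat \<Rightarrow> real" and K p x :: real
  assumes D: "\<And>m. m \<in> {1..n} \<Longrightarrow> (\<lambda>(e, y). D m e y) \<in> borel_measurable (Hist m \<Otimes>\<^sub>M N)"
    and D_bound: "\<And>m e y. m \<in> {1..n} \<Longrightarrow> e \<in> space (Hist m) \<Longrightarrow> y \<in> space N \<Longrightarrow> \<bar>D m e y\<bar> \<le> c m * G m y"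
    and D_zero: "\<And>m e. m \<in> {1..n} \<Longrightarrow> e \<in> space (Hist m) \<Longrightarrow> (\<integral>y. D m e y \<partial>law m) = 0"
    and c: "\<And>m. m \<in> {1..n} \<Longrightarrow> 0 \<le> c m" "\<And>m. m \<in> {1..n} \<Longrightarrow> c m \<le> 1"
    and G: "\<And>m. m \<in> {1..n} \<Longrightarrow> G m \<in> borel_measurable N"
    and G_nonneg: "\<And>m y. m \<in> {1..n} \<Longrightarrow> y \<in> space N \<Longrightarrow> 0 \<le> G m y"
    and p: "0 < p" "p < 1"
    and Kc_nonneg: "\<And>m. m \<in> {1..n} \<Longrightarrow> 0 \<le> Kc m"
    and moment: "\<And>m. m \<in> {1..n} \<Longrightarrow>
      (\<integral>\<^sup>+ y. ennreal ((G m y)\<^sup>2 * exp (G m y powr p)) \<partial>law m) \<le> ennreal (Kc m)"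
    and K: "(\<Sum>m=1..n. (c m)\<^sup>2 * Kc m) \<le> K" "1 \<le> K"
    and x: "0 < x"
  shows "prob {\<omega> \<in> space M. x \<le> (\<Sum>m=1..n. D m (hist m \<omega>) (eps m \<omega>))}
    \<le> 2 * exp (- x\<^sup>2 / (2 * (K + x powr (2 - p))))"
proof -
  define R where "R = exp (- x\<^sup>2 / (2 * (K + x powr (2 - p))))"
  obtain l b where l: "0 \<le> l" "l \<le> b powr (p - 1)" and b: "0 < b"
    and trunc: "exp (- l * x + l\<^sup>2 / 2 * K) \<le> R" and tail: "K / (b\<^sup>2 * exp (b powr p)) \<le> R"
    unfolding R_def using exists_truncation_level[OF x K(2) p] by metis
  define Y where "Y m \<omega> = D m (hist m \<omega>) (eps m \<omega>)" for m \<omega>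
  define Phi where "Phi m y = (G m y)\<^sup>2 * exp (G m y powr p)" for m y
  have Y_meas: "Y m \<in> borel_measurable M" if m: "m \<in> {1..n}" for m
  proof -
    note [measurable] = D[OF m]
    have [measurable]: "eps m \<in> measurable M N"
      using m by (intro measurable_eps) simp
    show ?thesis
      unfolding Y_def by measurable
  qed
  have Phi_meas: "Phi m \<in> borel_measurable N" if "m \<in> {1..n}" for m
    using G[OF that] unfolding Phi_def[abs_def] by measurable
  have Phi_nonneg: "0 \<le> Phi m y" for m y
    by (simp add: Phi_def)
  have Phi_int: "integrable (law m) (Phi m)" if m: "m \<in> {1..n}" for m
    using Phi_meas[OF m] Phi_nonneg moment[OF m]
    by (intro integrableI_bounded) (auto simp: Phi_def intro: le_less_trans)
  have Phi_le: "(\<integral>y. Phi m y \<partial>law m) \<le> Kc m" if m: "m \<in> {1..n}" for m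
  proof -
    have "ennreal (\<integral>y. Phi m y \<partial>law m) \<le> ennreal (Kc m)"
      using moment[OF m] Phi_int[OF m] Phi_nonneg
      by (subst nn_integral_eq_integral[symmetric]) (auto simp: Phi_def)
    then show ?thesis
      using Kc_nonneg[OF m] by simp
  qed
  \<comment> \<open>Here \<open>c m \<le> 1\<close> is used: shrinking \<open>G m y\<close> can only
    decrease the exponential factor, while the square yields the weight
    \<open>(c m)^2\<close>.\<close>
  have scaled: "(c m * G m y)\<^sup>2 * exp ((c m * G m y) powr p) \<le> (c m)\<^sup>2 * Phi m y"
    if m: "m \<in> {1..n}" and y: "y \<in> space N" for m y
  proof -
    have "c m * G m y \<le> G m y"
      using c[OF m] G_nonneg[OF m y] by (simp add: mult_left_le_one_le)
    then have "(c m * G m y) powr p \<le> G m y powr p"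
      using c[OF m] G_nonneg[OF m y] p by (intro powr_mono2) auto
    then have "(c m * G m y)\<^sup>2 * exp ((c m * G m y) powr p) \<le> (c m * G m y)\<^sup>2 * exp (G m y powr p)"
      by (intro mult_left_mono) auto
    then show ?thesis
      by (simp add: Phi_def power_mult_distrib mult.assoc)
  qed
  \<comment> \<open>The truncation is one-sided: very negative differences need no cut, since the
    quadratic bound for \<open>exp\<close> holds on the whole negative half-line.\<close>
  define h where "h m e y = ennreal (if D m e y \<le> b then exp (l * D m e y) else 0)" for m e y
  have h_meas: "(\<lambda>(e, y). h m e y) \<in> borel_measurable (Hist m \<Otimes>\<^sub>M N)" if m: "m \<in> {1..n}" for m
    using D[OF m] unfolding h_def by measurable
  have h_le: "(\<integral>\<^sup>+ y. h m e y \<partial>law m) \<le> ennreal (exp (l\<^sup>2 / 2 * ((c m)\<^sup>2 * Kc m)))"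
    if m: "m \<in> {1..n}" and e: "e \<in> space (Hist m)" for m e
  proof -
    interpret law: prob_space "law m"
      using m by (intro prob_space_law) simp
    note [measurable] = D[OF m] G[OF m] Phi_meas[OF m]
    have D_meas [measurable]: "D m e \<in> borel_measurable N"
      using e by measurable
    have G_int: "integrable (law m) (G m)"
      using G_nonneg[OF m] moment[OF m] by (intro law.integrable_of_square_exp[where p=p]) (auto intro: le_less_trans)
    have D_int: "integrable (law m) (D m e)"
    proof (rule Bochner_Integration.integrable_bound)
      show "integrable (law m) (\<lambda>y. c m * G m y)"
        using G_int by simp
      show "AE y in law m. norm (D m e y) \<le> norm (c m * G m y)"
        using D_bound[OF m e] by (auto intro!: AE_I2 order_trans[OF _ abs_ge_self])
    qed measurable
    \<comment> \<open>An integrable majorant of the truncated exponential whose linear term has mean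
      zero, so only the second-order term survives.\<close>
    define r where "r y = 1 + l * D m e y + l\<^sup>2 / 2 * ((c m)\<^sup>2 * Phi m y)" for y
    have hr: "(if D m e y \<le> b then exp (l * D m e y) else 0) \<le> r y" if y: "y \<in> space N" for y
    proof -
      have "(if D m e y \<le> b then exp (l * D m e y) else 0)
          \<le> 1 + l * D m e y + l\<^sup>2 / 2 * ((c m * G m y)\<^sup>2 * exp ((c m * G m y) powr p))"
        by (rule truncated_exp_le[OF l b p D_bound[OF m e y]])
      also have "\<dots> \<le> r y"
        unfolding r_def using scaled[OF m y] by (intro add_left_mono mult_left_mono) auto
      finally show ?thesis .
    qed
    \<comment> \<open>Not visible from the formula, as \<open>D m e y\<close> may be negative; it
      holds because \<open>r\<close> dominates a nonnegative quantity.\<close>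
    have r_nonneg: "0 \<le> r y" if "y \<in> space N" for y
      using hr[OF that] by (auto split: if_splits intro: order_trans[OF less_imp_le[OF exp_gt_zero]])
    have "(\<integral>\<^sup>+ y. h m e y \<partial>law m) \<le> (\<integral>\<^sup>+ y. ennreal (r y) \<partial>law m)"
      unfolding h_def using hr by (intro nn_integral_mono ennreal_leI) simp
    also have "\<dots> = ennreal (\<integral>y. r y \<partial>law m)"
    proof (intro nn_integral_eq_integral)
      show "integrable (law m) r"
        unfolding r_def[abs_def] using D_int Phi_int[OF m] by simp
      show "AE y in law m. 0 \<le> r y"
        using r_nonneg by (intro AE_I2) simp
    qed
    also have "(\<integral>y. r y \<partial>law m) = 1 + l\<^sup>2 / 2 * ((c m)\<^sup>2 * (\<integral>y. Phi m y \<partial>law m))"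
      unfolding r_def using D_int Phi_int[OF m] D_zero[OF m e] law.prob_space by simp
    also have "ennreal \<dots> \<le> ennreal (1 + l\<^sup>2 / 2 * ((c m)\<^sup>2 * Kc m))"
      using Phi_le[OF m] by (intro ennreal_leI add_left_mono mult_left_mono) auto
    also have "\<dots> \<le> ennreal (exp (l\<^sup>2 / 2 * ((c m)\<^sup>2 * Kc m)))"
      by (intro ennreal_leI exp_ge_add_one_self)
    finally show ?thesis .
  qed
  have big: "prob {\<omega> \<in> space M. b < Y m \<omega>} \<le> (c m)\<^sup>2 * Kc m / (b\<^sup>2 * exp (b powr p))"
    if m: "m \<in> {1..n}" for m
  proof -
    note [measurable] = Y_meas[OF m] Phi_meas[OF m]
    have eps [measurable]: "eps m \<in> measurable M N"
      using m by (intro measurable_eps) simp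
    have int: "integrable M (\<lambda>\<omega>. Phi m (eps m \<omega>))"
      using Phi_int[OF m] unfolding law_def by (subst (asm) integrable_distr_eq) auto
    have exp_eq: "expectation (\<lambda>\<omega>. Phi m (eps m \<omega>)) = (\<integral>y. Phi m y \<partial>law m)"
      unfolding law_def by (subst integral_distr) auto
    \<comment> \<open>The map \<open>t \<mapsto> t^2 * exp (t powr p)\<close> increases for
      nonnegative \<open>t\<close>, so Markov's inequality can be applied to \<open>Phi\<close>
      instead of the difference itself.\<close>
    have sub: "{\<omega> \<in> space M. b < Y m \<omega>}
        \<subseteq> {\<omega> \<in> space M. b\<^sup>2 * exp (b powr p) \<le> (c m)\<^sup>2 * Phi m (eps m \<omega>)}"
    proof safe
      fix \<omega> assume \<omega>: "\<omega> \<in> space M" and "b < Y m \<omega>"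
      have y: "eps m \<omega> \<in> space N"
        using measurable_space[OF eps \<omega>] .
      then have bG: "b \<le> c m * G m (eps m \<omega>)"
        using D_bound[OF m hist_in_space[OF \<omega>] y] \<open>b < Y m \<omega>\<close> unfolding Y_def by linarith
      have "b\<^sup>2 * exp (b powr p)
          \<le> (c m * G m (eps m \<omega>))\<^sup>2 * exp ((c m * G m (eps m \<omega>)) powr p)"
        using bG b p by (intro mult_mono power_mono) (auto intro!: powr_mono2)
      also have "\<dots> \<le> (c m)\<^sup>2 * Phi m (eps m \<omega>)"
        by (rule scaled[OF m y])
      finally show "b\<^sup>2 * exp (b powr p) \<le> (c m)\<^sup>2 * Phi m (eps m \<omega>)" .
    qed
    have "prob {\<omega> \<in> space M. b < Y m \<omega>}
        \<le> prob {\<omega> \<in> space M. b\<^sup>2 * exp (b powr p) \<le> (c m)\<^sup>2 * Phi m (eps m \<omega>)}"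
      by (intro finite_measure_mono[OF sub]) measurable
    also have "\<dots> \<le> expectation (\<lambda>\<omega>. (c m)\<^sup>2 * Phi m (eps m \<omega>)) / (b\<^sup>2 * exp (b powr p))"
      using b int Phi_nonneg by (intro integral_Markov_inequality_measure[where A="{}"]) auto
    also have "\<dots> = (c m)\<^sup>2 * (\<integral>y. Phi m y \<partial>law m) / (b\<^sup>2 * exp (b powr p))"
      by (simp add: exp_eq)
    also have "\<dots> \<le> (c m)\<^sup>2 * Kc m / (b\<^sup>2 * exp (b powr p))"
      using Phi_le[OF m] by (intro divide_right_mono mult_left_mono) auto
    finally show ?thesis .
  qed
  \<comment> \<open>On this event no factor \<open>h\<close> is cut to zero, so their product is the
    exponential of \<open>l\<close> times the full sum.\<close>
  define A where "A = {\<omega> \<in> space M. x \<le> (\<Sum>m=1..n. Y m \<omega>) \<and> (\<forall>m\<in>{1..n}. Y m \<omega> \<le> b)}"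
  have A_meas: "A \<in> sets M"
    unfolding A_def using Y_meas by measurable
  have "emeasure M A \<le> (\<integral>\<^sup>+ \<omega>. ennreal (exp (- l * x)) * (\<Prod>m=1..n. h m (hist m \<omega>) (eps m \<omega>)) \<partial>M)"
  proof -
    have "emeasure M A = (\<integral>\<^sup>+ \<omega>. indicator A \<omega> \<partial>M)"
      using A_meas by simp
    also have "\<dots> \<le> (\<integral>\<^sup>+ \<omega>. ennreal (exp (- l * x)) * (\<Prod>m=1..n. h m (hist m \<omega>) (eps m \<omega>)) \<partial>M)"
    proof (intro nn_integral_mono)
      fix \<omega> assume "\<omega> \<in> space M"
      show "indicator A \<omega> \<le> ennreal (exp (- l * x)) * (\<Prod>m=1..n. h m (hist m \<omega>) (eps m \<omega>))"
      proof (cases "\<omega> \<in> A")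
        case True
        have "(\<Prod>m=1..n. h m (hist m \<omega>) (eps m \<omega>)) = (\<Prod>m=1..n. ennreal (exp (l * Y m \<omega>)))"
          using True by (intro prod.cong) (auto simp: h_def A_def Y_def)
        also have "\<dots> = ennreal (exp (l * (\<Sum>m=1..n. Y m \<omega>)))"
          by (simp add: prod_ennreal exp_sum sum_distrib_left)
        finally have "ennreal (exp (- l * x)) * (\<Prod>m=1..n. h m (hist m \<omega>) (eps m \<omega>))
            = ennreal (exp (l * ((\<Sum>m=1..n. Y m \<omega>) - x)))"
          by (simp add: ennreal_mult[symmetric] exp_add[symmetric] algebra_simps)
        moreover have "0 \<le> l * ((\<Sum>m=1..n. Y m \<omega>) - x)"
          using True l by (simp add: A_def)
        ultimately show ?thesis
          using True by simp
      qed simp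
    qed
    finally show ?thesis .
  qed
  also have "\<dots> = ennreal (exp (- l * x)) * (\<integral>\<^sup>+ \<omega>. (\<Prod>m=1..n. h m (hist m \<omega>) (eps m \<omega>)) \<partial>M)"
  proof (intro nn_integral_cmult borel_measurable_prod_ennreal)
    fix m assume m: "m \<in> {1..n}"
    note [measurable] = h_meas[OF m]
    have [measurable]: "eps m \<in> measurable M N"
      using m by (intro measurable_eps) simp
    show "(\<lambda>\<omega>. h m (hist m \<omega>) (eps m \<omega>)) \<in> borel_measurable M"
      by measurable
  qed
  also have "\<dots> \<le> ennreal (exp (- l * x)) * (\<Prod>m=1..n. ennreal (exp (l\<^sup>2 / 2 * ((c m)\<^sup>2 * Kc m))))"
    using h_meas h_le by (intro mult_left_mono nn_integral_prod_le) auto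
  also have "\<dots> = ennreal (exp (- l * x + l\<^sup>2 / 2 * (\<Sum>m=1..n. (c m)\<^sup>2 * Kc m)))"
    by (simp add: prod_ennreal exp_sum[symmetric] exp_add[symmetric] ennreal_mult[symmetric] sum_distrib_left)
  also have "\<dots> \<le> ennreal (exp (- l * x + l\<^sup>2 / 2 * K))"
    using K(1) by (simp add: mult_left_mono)
  also have "\<dots> \<le> ennreal R"
    using trunc by (rule ennreal_leI)
  finally have PA: "prob A \<le> R"
    unfolding emeasure_eq_measure by (simp add: R_def)
  have PB: "prob (\<Union>m\<in>{1..n}. {\<omega> \<in> space M. b < Y m \<omega>}) \<le> R"
  proof -
    have "prob (\<Union>m\<in>{1..n}. {\<omega> \<in> space M. b < Y m \<omega>})
        \<le> (\<Sum>m=1..n. prob {\<omega> \<in> space M. b < Y m \<omega>})"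
      using Y_meas by (intro finite_measure_subadditive_finite) auto
    also have "\<dots> \<le> (\<Sum>m=1..n. (c m)\<^sup>2 * Kc m / (b\<^sup>2 * exp (b powr p)))"
      by (intro sum_mono big)
    also have "\<dots> \<le> K / (b\<^sup>2 * exp (b powr p))"
      unfolding sum_divide_distrib[symmetric] using K(1) b by (intro divide_right_mono) auto
    finally show ?thesis
      using tail by linarith
  qed
  have "prob {\<omega> \<in> space M. x \<le> (\<Sum>m=1..n. Y m \<omega>)}
      \<le> prob (A \<union> (\<Union>m\<in>{1..n}. {\<omega> \<in> space M. b < Y m \<omega>}))"
    using A_meas Y_meas by (intro finite_measure_mono) (auto simp: A_def not_less)
  also have "\<dots> \<le> prob A + prob (\<Union>m\<in>{1..n}. {\<omega> \<in> space M. b < Y m \<omega>})"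
    using A_meas Y_meas by (intro measure_Un_le) auto
  finally show ?thesis
    using PA PB unfolding Y_def R_def by linarith
qed

end

section \<open>Contracting chains with infinite memory\<close>

text \<open>Since \<open>acum a 0 = 1\<close>, the separate summand \<open>a k\<close> is the term
  \<open>l = 0\<close> of the convolution.\<close>

lemma acum_eq: "acum a k = 1 + (\<Sum>l<k. acum a l * a (k - l))"
proof (cases k)
  case (Suc j)
  have "(\<Sum>l<Suc j. acum a l * a (Suc j - l))
      = acum a 0 * a (Suc j - 0) + (\<Sum>l\<in>{1..<Suc j}. acum a l * a (Suc j - l))"
    unfolding lessThan_atLeast0 by (subst sum.atLeast_Suc_lessThan) auto
  then show ?thesis
    using Suc by simp
qed simp

lemma acum_ge_1:
  assumes "\<And>i. 1 \<le> i \<Longrightarrow> 0 \<le> a i"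
  shows "1 \<le> acum a k"
proof (induction k rule: less_induct)
  case (less k)
  then have "0 \<le> (\<Sum>l<k. acum a l * a (k - l))"
    using assms by (intro sum_nonneg mult_nonneg_nonneg) (auto intro: order_trans[OF zero_le_one])
  then show ?case
    by (subst acum_eq) simp
qed

text \<open>Term \<open>l\<close> of the sum for \<open>k\<close> is compared with term
  \<open>l + 1\<close> of the sum for \<open>k + 1\<close>: both carry the factor
  \<open>a (k - l)\<close>, and the extra term \<open>l = 0\<close> is nonnegative.\<close>

lemma acum_mono:
  assumes a: "\<And>i. 1 \<le> i \<Longrightarrow> 0 \<le> a i" and "j \<le> k"
  shows "acum a j \<le> acum a k"
proof (rule lift_Suc_mono_le[OF _ \<open>j \<le> k\<close>])
  fix k show "acum a k \<le> acum a (Suc k)"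
  proof (induction k rule: less_induct)
    case (less k)
    have "(\<Sum>l<k. acum a l * a (k - l)) \<le> (\<Sum>l<k. acum a (Suc l) * a (Suc k - Suc l))"
      using less a acum_ge_1[of a] order_trans[OF zero_le_one]
      by (intro sum_mono mult_mono) (auto simp del: acum.simps)
    also have "\<dots> \<le> (\<Sum>l<Suc k. acum a l * a (Suc k - l))"
      unfolding sum.lessThan_Suc_shift using a acum_ge_1[of a] by simp
    finally show ?case
      by (subst (1 2) acum_eq) simp
  qed
qed

text \<open>Lipschitz constant, in the \<open>j\<close>-th entry of the past of time \<open>n - k + 1\<close>, of the conditional
  expectation of a separately 1-Lipschitz function of \<open>X 1, \<dots>, X n\<close>.\<close>

definition past_weight :: "(nat \<Rightarrow> real) \<Rightarrow> nat \<Rightarrow> nat \<Rightarrow> real" where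
  "past_weight a k j = 1 + (\<Sum>l<k. acum a l * a (j + k - l))"

lemma past_weight_0 [simp]: "past_weight a k 0 = acum a k"
  by (subst acum_eq) (simp add: past_weight_def)

text \<open>Extending a past moves entry \<open>j\<close> to entry \<open>j + 1\<close>; the second
  summand is its influence through the newly generated value.\<close>

lemma past_weight_Suc: "past_weight a (Suc k) j = past_weight a k (Suc j) + acum a k * a (Suc j)"
  by (simp add: past_weight_def)

text \<open>The source of measurability for \<open>g\<close>: the bound involves finitely many
  coordinates, each continuous in the product topology.\<close>

lemma continuous_on_lipschitz_coordinates:
  fixes g :: "(nat \<Rightarrow> 'a::metric_space) \<Rightarrow> real"
  assumes "\<And>u u'. \<bar>g u - g u'\<bar> \<le> (\<Sum>j<n. dist (u j) (u' j))"
  shows "continuous_on UNIV g"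
proof (intro continuous_at_imp_continuous_on ballI)
  fix u :: "nat \<Rightarrow> 'a"
  have coord: "((\<lambda>v. v j) \<longlongrightarrow> u j) (at u)" for j
    using continuous_on_product_coordinates[of j] by (auto simp: continuous_on_def)
  have "((\<lambda>v. \<Sum>j<n. dist (v j) (u j)) \<longlongrightarrow> (\<Sum>j<n. dist (u j) (u j))) (at u)"
    by (intro tendsto_sum tendsto_dist tendsto_const coord)
  then have "((\<lambda>v. \<Sum>j<n. dist (v j) (u j)) \<longlongrightarrow> 0) (at u)"
    by simp
  then have "((\<lambda>v. g v - g u) \<longlongrightarrow> 0) (at u)"
    by (rule Lim_null_comparison[rotated]) (auto intro!: always_eventually simp: assms)
  then show "isCont g u"
    unfolding isCont_def by (rule LIM_zero_cancel)
qed

text \<open>A past is a sequence whose entry \<open>0\<close> is the most recent value, so \<open>case_nat v u\<close> is the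
  past \<open>u\<close> extended by the new value \<open>v\<close>.\<close>

locale contracting_chain = innovations M borel eps
  for M :: "'w measure" and eps :: "nat \<Rightarrow> 'w \<Rightarrow> 'b::polish_space" +
  fixes F :: "nat \<Rightarrow> (nat \<Rightarrow> 'a::polish_space) \<Rightarrow> 'b \<Rightarrow> 'a"
    and a :: "nat \<Rightarrow> real"
    and n :: nat
    and g :: "(nat \<Rightarrow> 'a) \<Rightarrow> real"
    and u0 :: "nat \<Rightarrow> 'a"
  assumes F_meas: "\<And>m. 1 \<le> m \<Longrightarrow>
      (\<lambda>(u, y). F m u y) \<in> borel_measurable (Pi\<^sub>M UNIV (\<lambda>_::nat. borel) \<Otimes>\<^sub>M borel)"
    and a_nonneg: "\<And>i. 1 \<le> i \<Longrightarrow> 0 \<le> a i"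
    and contraction: "\<And>m u u'. 1 \<le> m \<Longrightarrow>
      (\<integral>\<^sup>+ y. ennreal (dist (F m u y) (F m u' y)) \<partial>law m)
        \<le> (\<Sum>j. ennreal (a (Suc j) * dist (u j) (u' j)))"
    and F_lip: "\<And>m u y y'. 1 \<le> m \<Longrightarrow> dist (F m u y) (F m u y') \<le> dist y y'"
    and g_lip: "\<And>u u'. \<bar>g u - g u'\<bar> \<le> (\<Sum>j<n. dist (u j) (u' j))"
    and dist_int: "\<And>m y. m \<in> {1..n} \<Longrightarrow> integrable (law m) (dist y)"
begin

text \<open>\<open>cond_mean k u\<close> is the conditional expectation of \<open>g\<close> of the past of time \<open>n + 1\<close>, given that the
  past of time \<open>n - k + 1\<close> is \<open>u\<close>.\<close>

primrec cond_mean :: "nat \<Rightarrow> (nat \<Rightarrow> 'a) \<Rightarrow> real" where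
  "cond_mean 0 u = g u"
| "cond_mean (Suc k) u = (\<integral>y. cond_mean k (case_nat (F (n - k) u y) u) \<partial>law (n - k))"

text \<open>The past of time \<open>m + 1\<close> generated by \<open>e 1, ..., e m\<close>;
  \<open>u0\<close> is the past of time 1.\<close>

primrec state :: "nat \<Rightarrow> (nat \<Rightarrow> 'b) \<Rightarrow> nat \<Rightarrow> 'a" where
  "state 0 e = u0"
| "state (Suc m) e = case_nat (F (Suc m) (state m e) (e (Suc m))) (state m e)"

text \<open>Real-valued counterpart of \<open>mean_dist\<close>; by \<open>dist_int\<close> the
  integral is a genuine one at the times \<open>1..n\<close>.\<close>

definition mean_gap :: "nat \<Rightarrow> 'b \<Rightarrow> real" where
  "mean_gap m y = (\<integral>y'. dist y y' \<partial>law m)"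

text \<open>The martingale difference at time \<open>m\<close>, with the history \<open>e\<close>
  frozen and \<open>y\<close> as new innovation. As \<open>cond_mean\<close> counts remaining steps,
  \<open>n - m\<close> refers to the time after \<open>y\<close> is revealed and
  \<open>n - (m - 1)\<close> to the time before.\<close>

definition increment :: "nat \<Rightarrow> (nat \<Rightarrow> 'b) \<Rightarrow> 'b \<Rightarrow> real" where
  "increment m e y = cond_mean (n - m) (case_nat (F m (state (m - 1) e) y) (state (m - 1) e))
     - cond_mean (n - (m - 1)) (state (m - 1) e)"

lemma continuous_F: "1 \<le> m \<Longrightarrow> continuous_on UNIV (F m u)"
  using F_lip by (intro lipschitz_on_continuous_on[of 1] lipschitz_onI) auto

lemma measurable_F [measurable]: "1 \<le> m \<Longrightarrow> F m u \<in> borel_measurable borel"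
  by (intro borel_measurable_continuous_onI continuous_F)

text \<open>Agreement from entry \<open>k\<close> on turns the series into a finite sum, so the
  extended-valued contraction becomes a bound between real integrals.\<close>

lemma contraction_finite:
  assumes m: "1 \<le> m" and agree: "\<And>j. k \<le> j \<Longrightarrow> u j = u' j"
  shows "integrable (law m) (\<lambda>y. dist (F m u y) (F m u' y))"
    and "(\<integral>y. dist (F m u y) (F m u' y) \<partial>law m) \<le> (\<Sum>j<k. a (Suc j) * dist (u j) (u' j))"
proof -
  note [measurable] = measurable_F[OF m]
  have nn: "0 \<le> (\<Sum>j<k. a (Suc j) * dist (u j) (u' j))"
    using a_nonneg by (intro sum_nonneg) auto
  have "(\<integral>\<^sup>+ y. ennreal (dist (F m u y) (F m u' y)) \<partial>law m)
      \<le> (\<Sum>j. ennreal (a (Suc j) * dist (u j) (u' j)))"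
    by (rule contraction[OF m])
  also have "\<dots> = (\<Sum>j<k. ennreal (a (Suc j) * dist (u j) (u' j)))"
    using agree by (intro suminf_finite) auto
  also have "\<dots> = ennreal (\<Sum>j<k. a (Suc j) * dist (u j) (u' j))"
    using a_nonneg by (intro sum_ennreal) auto
  finally have le: "(\<integral>\<^sup>+ y. ennreal (dist (F m u y) (F m u' y)) \<partial>law m)
      \<le> ennreal (\<Sum>j<k. a (Suc j) * dist (u j) (u' j))" .
  show int: "integrable (law m) (\<lambda>y. dist (F m u y) (F m u' y))"
    using le by (intro integrableI_bounded) (auto intro: le_less_trans)
  show "(\<integral>y. dist (F m u y) (F m u' y) \<partial>law m) \<le> (\<Sum>j<k. a (Suc j) * dist (u j) (u' j))"
    using le nn nn_integral_eq_integral[OF int] by simp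
qed

text \<open>A Lipschitz function grows at most linearly in the distance to a fixed point, which is
  integrable by \<open>dist_int\<close>.\<close>

lemma integrable_lipschitz:
  fixes \<phi> :: "'b \<Rightarrow> real"
  assumes m: "m \<in> {1..n}" and lip: "\<And>y y'. \<bar>\<phi> y - \<phi> y'\<bar> \<le> L * dist y y'" and L: "0 \<le> L"
  shows "integrable (law m) \<phi>"
proof (rule Bochner_Integration.integrable_bound)
  interpret law: prob_space "law m"
    using m by (intro prob_space_law) simp
  fix z :: 'b
  have "continuous_on UNIV \<phi>"
    using lip L by (intro lipschitz_on_continuous_on[of L] lipschitz_onI) (auto simp: dist_real_def)
  then show "\<phi> \<in> borel_measurable (law m)"
    using borel_measurable_continuous_onI[of \<phi>] by simp
  show "integrable (law m) (\<lambda>y. \<bar>\<phi> z\<bar> + L * dist z y)"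
    using dist_int[OF m] by simp
  have "\<bar>\<phi> y\<bar> \<le> \<bar>\<phi> z\<bar> + L * dist z y" for y
    using lip[of z y] by linarith
  then show "AE y in law m. norm (\<phi> y) \<le> norm (\<bar>\<phi> z\<bar> + L * dist z y)"
    by (auto intro!: AE_I2 order_trans[OF _ abs_ge_self])
qed

text \<open>Backward induction: the next value has weight \<open>acum a k\<close>, its mean
  displacement is bounded by the contraction, and \<open>past_weight_Suc\<close> collects the terms.
  Entries from \<open>n - k\<close> on belong to times up to 0, where all pasts of the chain
  agree.\<close>

lemma cond_mean_lipschitz:
  assumes "k \<le> n" and "\<And>j. n - k \<le> j \<Longrightarrow> u j = u' j"
  shows "\<bar>cond_mean k u - cond_mean k u'\<bar> \<le> (\<Sum>j<n - k. past_weight a k j * dist (u j) (u' j))"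
  using assms
proof (induction k arbitrary: u u')
  case 0
  then show ?case
    using g_lip by (simp add: past_weight_def)
next
  case (Suc k)
  define m where "m = n - k"
  have m: "m \<in> {1..n}" "1 \<le> m" "Suc (m - 1) = m" and mk: "n - Suc k = m - 1"
    using Suc.prems(1) by (auto simp: m_def)
  interpret law: prob_space "law m"
    using m by (intro prob_space_law) simp
  define \<phi> where "\<phi> w y = cond_mean k (case_nat (F m w y) w)" for w y
  define C where "C = (\<Sum>j<m - 1. past_weight a k (Suc j) * dist (u j) (u' j))"
  have step: "\<bar>cond_mean k (case_nat v w) - cond_mean k (case_nat v' w')\<bar>
      \<le> acum a k * dist v v' + (\<Sum>j<m - 1. past_weight a k (Suc j) * dist (w j) (w' j))"
    if w: "\<And>j. m - 1 \<le> j \<Longrightarrow> w j = w' j" for v v' w w'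
  proof -
    have "\<bar>cond_mean k (case_nat v w) - cond_mean k (case_nat v' w')\<bar>
        \<le> (\<Sum>j<m. past_weight a k j * dist (case_nat v w j) (case_nat v' w' j))"
      unfolding m_def
    proof (rule Suc.IH)
      fix j assume "n - k \<le> j"
      then obtain i where "j = Suc i" "m - 1 \<le> i"
        using m by (cases j) (auto simp: m_def)
      then show "case_nat v w j = case_nat v' w' j"
        using w by simp
    qed (use Suc.prems in simp)
    also have "\<dots> = (\<Sum>j<Suc (m - 1). past_weight a k j * dist (case_nat v w j) (case_nat v' w' j))"
      using m by simp
    finally show ?thesis
      unfolding sum.lessThan_Suc_shift by simp
  qed
  have acum: "0 \<le> acum a k"
    using acum_ge_1[of a k] a_nonneg by simp
  \<comment> \<open>Integrability for each single past, through the Lipschitz dependence on the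
    innovation, is what allows the two integrals to be subtracted.\<close>
  have \<phi>_int: "integrable (law m) (\<phi> w)" for w
  proof (rule integrable_lipschitz[OF m(1) _ acum])
    fix y y'
    have "\<bar>\<phi> w y - \<phi> w y'\<bar> \<le> acum a k * dist (F m w y) (F m w y')"
      using step[of w w "F m w y" "F m w y'"] by (simp add: \<phi>_def)
    also have "\<dots> \<le> acum a k * dist y y'"
      by (intro mult_left_mono F_lip m acum)
    finally show "\<bar>\<phi> w y - \<phi> w y'\<bar> \<le> acum a k * dist y y'" .
  qed
  have agree: "u j = u' j" if "m - 1 \<le> j" for j
    using Suc.prems(2) that mk by simp
  have ctr: "integrable (law m) (\<lambda>y. dist (F m u y) (F m u' y))"
      "(\<integral>y. dist (F m u y) (F m u' y) \<partial>law m) \<le> (\<Sum>j<m - 1. a (Suc j) * dist (u j) (u' j))"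
    using agree by (auto intro: contraction_finite[OF m(2)])
  have step_uu': "\<bar>\<phi> u y - \<phi> u' y\<bar> \<le> acum a k * dist (F m u y) (F m u' y) + C" for y
    unfolding \<phi>_def C_def by (rule step) (rule agree)
  have "\<bar>cond_mean (Suc k) u - cond_mean (Suc k) u'\<bar> = \<bar>\<integral>y. \<phi> u y - \<phi> u' y \<partial>law m\<bar>"
    using Bochner_Integration.integral_diff[OF \<phi>_int \<phi>_int, of u u'] by (simp add: \<phi>_def[abs_def] m_def[symmetric])
  also have "\<dots> \<le> (\<integral>y. \<bar>\<phi> u y - \<phi> u' y\<bar> \<partial>law m)"
    by (rule integral_abs_bound)
  also have "\<dots> \<le> (\<integral>y. acum a k * dist (F m u y) (F m u' y) + C \<partial>law m)"
    using \<phi>_int ctr(1) step_uu' by (intro integral_mono) auto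
  also have "\<dots> = acum a k * (\<integral>y. dist (F m u y) (F m u' y) \<partial>law m) + C"
    using ctr(1) law.prob_space by simp
  also have "\<dots> \<le> acum a k * (\<Sum>j<m - 1. a (Suc j) * dist (u j) (u' j)) + C"
    by (intro add_right_mono mult_left_mono ctr(2) acum)
  also have "\<dots> = (\<Sum>j<n - Suc k. past_weight a (Suc k) j * dist (u j) (u' j))"
    by (simp add: C_def mk past_weight_Suc sum_distrib_left sum.distrib algebra_simps)
  finally show ?case .
qed

text \<open>The two extended pasts differ only in entry 0, whose weight is
  \<open>acum a (n - m)\<close>.\<close>

lemma cond_mean_innovation_lipschitz:
  assumes m: "m \<in> {1..n}"
  shows "\<bar>cond_mean (n - m) (case_nat (F m u y) u) - cond_mean (n - m) (case_nat (F m u y') u)\<bar>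
    \<le> acum a (n - m) * dist y y'"
proof -
  have "\<bar>cond_mean (n - m) (case_nat (F m u y) u) - cond_mean (n - m) (case_nat (F m u y') u)\<bar>
      \<le> (\<Sum>j<Suc (m - 1). past_weight a (n - m) j * dist (case_nat (F m u y) u j) (case_nat (F m u y') u j))"
    using cond_mean_lipschitz[of "n - m" "case_nat (F m u y) u" "case_nat (F m u y') u"] m
    by (auto split: nat.split)
  also have "\<dots> = acum a (n - m) * dist (F m u y) (F m u y')"
    unfolding sum.lessThan_Suc_shift by simp
  also have "\<dots> \<le> acum a (n - m) * dist y y'"
    using m F_lip acum_ge_1[of a "n - m"] a_nonneg by (intro mult_left_mono) auto
  finally show ?thesis .
qed

lemma cond_mean_unfold:
  assumes m: "m \<in> {1..n}"
  shows "cond_mean (n - (m - 1)) u = (\<integral>y. cond_mean (n - m) (case_nat (F m u y) u) \<partial>law m)"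
proof -
  have "n - (m - 1) = Suc (n - m)" "n - (n - m) = m"
    using m by auto
  then show ?thesis
    by simp
qed

lemma integrable_cond_mean:
  assumes m: "m \<in> {1..n}"
  shows "integrable (law m) (\<lambda>y. cond_mean (n - m) (case_nat (F m u y) u))"
  using cond_mean_innovation_lipschitz[OF m] acum_ge_1[of a "n - m"] a_nonneg
  by (intro integrable_lipschitz[OF m, where L="acum a (n - m)"]) auto

section \<open>Measurability of the conditional means and of the chain\<close>

lemma measurable_cond_mean [measurable]:
  "k \<le> n \<Longrightarrow> cond_mean k \<in> borel_measurable (Pi\<^sub>M UNIV (\<lambda>_. borel))"
proof (induction k)
  case 0
  \<comment> \<open>Continuity gives measurability for the Borel sets of the product topology, which
    coincide with the product sigma-algebra here.\<close>
  have "g \<in> borel_measurable borel"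
    by (intro borel_measurable_continuous_onI continuous_on_lipschitz_coordinates[where n=n] g_lip)
  then have "g \<in> borel_measurable (Pi\<^sub>M UNIV (\<lambda>_. borel))"
    by (simp add: measurable_cong_sets[OF sets_PiM_equal_borel refl])
  then show ?case
    by (simp add: fun_eq_iff[of "cond_mean 0" g, simplified])
next
  case (Suc k)
  define m where "m = n - k"
  have m: "1 \<le> m"
    using Suc.prems by (simp add: m_def)
  interpret law: prob_space "law m"
    by (rule prob_space_law[OF m])
  have [measurable]: "cond_mean k \<in> borel_measurable (Pi\<^sub>M UNIV (\<lambda>_. borel))"
    using Suc by simp
  note [measurable] = F_meas[OF m]
  have "(\<lambda>u. \<integral>y. cond_mean k (case_nat (F m u y) u) \<partial>law m) \<in> borel_measurable (Pi\<^sub>M UNIV (\<lambda>_. borel))"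
    by (intro law.borel_measurable_lebesgue_integral) measurable
  then show ?case
    by (simp add: m_def)
qed

lemma measurable_state: "m \<le> k \<Longrightarrow> state m \<in> measurable (Hist (Suc k)) (Pi\<^sub>M UNIV (\<lambda>_. borel))"
proof (induction m)
  case 0
  have "state 0 = (\<lambda>_. u0)"
    by (simp add: fun_eq_iff)
  then show ?case
    by (simp add: space_PiM)
next
  case (Suc m)
  then have [measurable]: "state m \<in> measurable (Hist (Suc k)) (Pi\<^sub>M UNIV (\<lambda>_. borel))"
    by simp
  have [measurable]: "(\<lambda>e. e (Suc m)) \<in> measurable (Hist (Suc k)) borel"
    using Suc.prems by (intro measurable_component_singleton) auto
  note [measurable] = F_meas[of "Suc m", simplified]
  show ?case
    unfolding state.simps by measurable
qed

lemma state_cong: "(\<And>i. i \<in> {0<..<Suc m} \<Longrightarrow> e i = e' i) \<Longrightarrow> state m e = state m e'"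
  by (induction m) auto

lemma state_hist: "m \<le> k \<Longrightarrow> state m (hist (Suc k) \<omega>) = state m (\<lambda>i. eps i \<omega>)"
  by (intro state_cong) (auto simp: hist_def)

lemma measurable_increment:
  assumes m: "m \<in> {1..n}"
  shows "(\<lambda>(e, y). increment m e y) \<in> borel_measurable (Hist m \<Otimes>\<^sub>M borel)"
proof -
  have [measurable]: "state (m - 1) \<in> measurable (Hist m) (Pi\<^sub>M UNIV (\<lambda>_. borel))"
    using measurable_state[of "m - 1" "m - 1"] m by simp
  have [measurable]: "cond_mean (n - m) \<in> borel_measurable (Pi\<^sub>M UNIV (\<lambda>_. borel))"
      "cond_mean (n - (m - 1)) \<in> borel_measurable (Pi\<^sub>M UNIV (\<lambda>_. borel))"
    using m by auto
  have [measurable]: "(\<lambda>(u, y). F m u y) \<in> borel_measurable (Pi\<^sub>M UNIV (\<lambda>_::nat. borel) \<Otimes>\<^sub>M borel)"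
    using m by (intro F_meas) simp
  show ?thesis
    unfolding increment_def by measurable
qed

section \<open>The martingale differences of the chain\<close>

lemma integral_increment_eq_0:
  assumes m: "m \<in> {1..n}"
  shows "(\<integral>y. increment m e y \<partial>law m) = 0"
proof -
  interpret law: prob_space "law m"
    using m by (intro prob_space_law) simp
  show ?thesis
    unfolding increment_def using integrable_cond_mean[OF m] cond_mean_unfold[OF m] law.prob_space by simp
qed

lemma mean_gap_nonneg: "0 \<le> mean_gap m y"
  by (simp add: mean_gap_def)

lemma measurable_mean_gap [measurable]: "1 \<le> m \<Longrightarrow> mean_gap m \<in> borel_measurable borel"
proof -
  assume "1 \<le> m"
  then interpret law: prob_space "law m"
    by (rule prob_space_law)
  show ?thesis
    unfolding mean_gap_def[abs_def] by measurable
qed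

text \<open>The earlier conditional mean averages over an independent copy \<open>y'\<close> of the
  innovation, so the increment is the mean of a difference between the values at \<open>y\<close>
  and \<open>y'\<close>.\<close>

lemma increment_bound:
  assumes m: "m \<in> {1..n}"
  shows "\<bar>increment m e y\<bar> \<le> acum a (n - m) * mean_gap m y"
proof -
  interpret law: prob_space "law m"
    using m by (intro prob_space_law) simp
  define \<phi> where "\<phi> y = cond_mean (n - m) (case_nat (F m (state (m - 1) e) y) (state (m - 1) e))" for y
  have int: "integrable (law m) \<phi>"
    unfolding \<phi>_def by (rule integrable_cond_mean[OF m])
  have lip: "\<bar>\<phi> y - \<phi> y'\<bar> \<le> acum a (n - m) * dist y y'" for y'
    unfolding \<phi>_def by (rule cond_mean_innovation_lipschitz[OF m])
  have "increment m e y = (\<integral>y'. \<phi> y - \<phi> y' \<partial>law m)"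
  proof -
    have "(\<integral>y'. \<phi> y - \<phi> y' \<partial>law m) = \<phi> y - (\<integral>y'. \<phi> y' \<partial>law m)"
      using int law.prob_space by simp
    then show ?thesis
      unfolding increment_def cond_mean_unfold[OF m] \<phi>_def by simp
  qed
  then have "\<bar>increment m e y\<bar> \<le> (\<integral>y'. \<bar>\<phi> y - \<phi> y'\<bar> \<partial>law m)"
    using integral_abs_bound[of "law m" "\<lambda>y'. \<phi> y - \<phi> y'"] by simp
  also have "\<dots> \<le> (\<integral>y'. acum a (n - m) * dist y y' \<partial>law m)"
    using int dist_int[OF m] lip by (intro integral_mono) auto
  finally show ?thesis
    by (simp add: mean_gap_def)
qed

text \<open>The conditional means along the chain telescope, from \<open>cond_mean n u0\<close> to
  \<open>g\<close> of the final past.\<close>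

lemma sum_increment:
  "(\<Sum>m=1..n. increment m (hist m \<omega>) (eps m \<omega>)) = g (state n (\<lambda>i. eps i \<omega>)) - cond_mean n u0"
proof -
  define V where "V m = cond_mean (n - m) (state m (\<lambda>i. eps i \<omega>))" for m
  have "increment (Suc i) (hist (Suc i) \<omega>) (eps (Suc i) \<omega>) = V (Suc i) - V i" if "i < n" for i
    using that by (simp add: increment_def V_def state_hist)
  then have "(\<Sum>m=1..n. increment m (hist m \<omega>) (eps m \<omega>)) = (\<Sum>i<n. V (Suc i) - V i)"
    by (simp add: sum.atLeast1_atMost_eq)
  also have "\<dots> = V n - V 0"
    by (rule sum_lessThan_telescope)
  finally show ?thesis
    by (simp add: V_def)
qed

text \<open>Identifies the centring: telescoping produces \<open>cond_mean n u0\<close>, and the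
  increments are integrable with mean zero.\<close>

lemma expectation_state:
  assumes gap: "\<And>m. m \<in> {1..n} \<Longrightarrow> integrable (law m) (mean_gap m)"
  shows "expectation (\<lambda>\<omega>. g (state n (\<lambda>i. eps i \<omega>))) = cond_mean n u0"
proof -
  define Y where "Y m \<omega> = increment m (hist m \<omega>) (eps m \<omega>)" for m \<omega>
  have Y_int: "integrable M (Y m)" if m: "m \<in> {1..n}" for m
  proof (rule Bochner_Integration.integrable_bound)
    have [measurable]: "eps m \<in> measurable M borel"
      using m by (intro measurable_eps) simp
    note [measurable] = measurable_increment[OF m]
    show "integrable M (\<lambda>\<omega>. acum a (n - m) * mean_gap m (eps m \<omega>))"
      using gap[OF m] m unfolding law_def by (subst (asm) integrable_distr_eq) auto
    show "Y m \<in> borel_measurable M"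
      unfolding Y_def by measurable
    show "AE \<omega> in M. norm (Y m \<omega>) \<le> norm (acum a (n - m) * mean_gap m (eps m \<omega>))"
      using increment_bound[OF m] by (auto simp: Y_def intro!: AE_I2 order_trans[OF _ abs_ge_self])
  qed
  have Y_zero: "expectation (Y m) = 0" if m: "m \<in> {1..n}" for m
    using m Y_int[OF m] measurable_increment[OF m] integral_increment_eq_0[OF m] unfolding Y_def
    by (intro expectation_hist_eps_eq_0) auto
  have "expectation (\<lambda>\<omega>. g (state n (\<lambda>i. eps i \<omega>))) = expectation (\<lambda>\<omega>. (\<Sum>m=1..n. Y m \<omega>) + cond_mean n u0)"
    unfolding Y_def sum_increment by simp
  also have "\<dots> = (\<Sum>m=1..n. expectation (Y m)) + cond_mean n u0"
    using Y_int by (subst Bochner_Integration.integral_add) (auto simp: prob_space intro!: Bochner_Integration.integral_sum)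
  finally show ?thesis
    using Y_zero by simp
qed

text \<open>Dividing the increments by \<open>A\<close>, the largest of the coefficients by
  \<open>acum_mono\<close>, makes the weights at most 1 and the level \<open>x / A\<close>. The sign
  \<open>s\<close> treats both tails at once.\<close>

lemma chain_deviation:
  fixes s p x K :: real and Kc :: "nat \<Rightarrow> real"
  defines "A \<equiv> acum a (n - 1)"
  assumes s: "s = 1 \<or> s = - 1"
    and p: "0 < p" "p < 1"
    and Kc_nonneg: "\<And>m. m \<in> {1..n} \<Longrightarrow> 0 \<le> Kc m"
    and moment: "\<And>m. m \<in> {1..n} \<Longrightarrow>
      (\<integral>\<^sup>+ y. ennreal ((mean_gap m y)\<^sup>2 * exp (mean_gap m y powr p)) \<partial>law m) \<le> ennreal (Kc m)"
    and K_def: "K = (\<Sum>m=1..n. (acum a (n - m) / A)\<^sup>2 * Kc m)"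
    and K_ge: "1 \<le> K"
    and x: "0 \<le> x"
  shows "prob {\<omega> \<in> space M. x \<le> s * (g (state n (\<lambda>i. eps i \<omega>)) - expectation (\<lambda>\<omega>. g (state n (\<lambda>i. eps i \<omega>))))}
    \<le> 2 * exp (- x\<^sup>2 / (2 * (K * A\<^sup>2 + x powr (2 - p) * A powr p)))"
    (is "prob {\<omega> \<in> space M. x \<le> s * ?S \<omega>} \<le> ?R")
proof (cases "x = 0")
  \<comment> \<open>At level 0 the right-hand side equals 2; the truncation argument requires a
    positive level.\<close>
  case True
  then show ?thesis
    using order_trans[OF prob_le_1] by simp
next
  case False
  then have x: "0 < x"
    using x by simp
  have A: "1 \<le> A"
    using acum_ge_1[of a] a_nonneg by (simp add: A_def)
  have gap: "integrable (law m) (mean_gap m)" if m: "m \<in> {1..n}" for m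
  proof -
    interpret law: prob_space "law m"
      using m by (intro prob_space_law) simp
    show ?thesis
      using moment[OF m] mean_gap_nonneg m
      by (intro law.integrable_of_square_exp[where p=p]) (auto intro: le_less_trans)
  qed
  have mean: "expectation (\<lambda>\<omega>. g (state n (\<lambda>i. eps i \<omega>))) = cond_mean n u0"
    by (rule expectation_state) (rule gap)
  have meas: "(\<lambda>(e, y). s * increment m e y / A) \<in> borel_measurable (Hist m \<Otimes>\<^sub>M borel)"
    if m: "m \<in> {1..n}" for m
  proof -
    note [measurable] = measurable_increment[OF m]
    show ?thesis
      by measurable
  qed
  have bound: "\<bar>s * increment m e y / A\<bar> \<le> acum a (n - m) / A * mean_gap m y" if m: "m \<in> {1..n}" for m e y
    using increment_bound[OF m, of e y] s A by (auto simp: abs_mult divide_right_mono)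
  have "prob {\<omega> \<in> space M. x / A \<le> (\<Sum>m=1..n. s * increment m (hist m \<omega>) (eps m \<omega>) / A)}
      \<le> 2 * exp (- (x / A)\<^sup>2 / (2 * (K + (x / A) powr (2 - p))))"
  proof (rule subexponential_deviation[where G=mean_gap and c="\<lambda>m. acum a (n - m) / A" and Kc=Kc])
    fix m assume m: "m \<in> {1..n}"
    have "0 \<le> acum a (n - m)" "acum a (n - m) \<le> A"
      using acum_ge_1[of a "n - m"] acum_mono[of a "n - m" "n - 1"] a_nonneg m by (auto simp: A_def)
    then show "0 \<le> acum a (n - m) / A" "acum a (n - m) / A \<le> 1"
      using A by auto
    show "(\<integral>y. s * increment m e y / A \<partial>law m) = 0" for e
      using integral_increment_eq_0[OF m] by simp
  qed (use A x p K_ge bound meas mean_gap_nonneg Kc_nonneg moment K_def in auto)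
  also have "{\<omega> \<in> space M. x / A \<le> (\<Sum>m=1..n. s * increment m (hist m \<omega>) (eps m \<omega>) / A)}
      = {\<omega> \<in> space M. x \<le> s * ?S \<omega>}"
  proof -
    have "(\<Sum>m=1..n. s * increment m (hist m \<omega>) (eps m \<omega>) / A) = s * ?S \<omega> / A" for \<omega>
      unfolding sum_divide_distrib[symmetric] sum_distrib_left[symmetric] sum_increment
      by (simp add: mean)
    then show ?thesis
      using A by (auto simp: divide_le_cancel)
  qed
  \<comment> \<open>The fraction is expanded by \<open>A^2 = A powr (2 - p) * A powr p\<close>,
    which undoes the normalisation.\<close>
  also have "2 * exp (- (x / A)\<^sup>2 / (2 * (K + (x / A) powr (2 - p)))) = ?R"
  proof -
    have "A powr (2 - p) * A powr p = A\<^sup>2"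
      using A by (simp add: powr_add[symmetric])
    then have "A\<^sup>2 * (K + (x / A) powr (2 - p)) = K * A\<^sup>2 + x powr (2 - p) * A powr p"
      using A x by (simp add: powr_divide field_simps)
    moreover have "(x / A)\<^sup>2 / (2 * (K + (x / A) powr (2 - p)))
        = x\<^sup>2 / (2 * (A\<^sup>2 * (K + (x / A) powr (2 - p))))"
      by (simp add: power_divide)
    ultimately show ?thesis
      by simp
  qed
  finally show ?thesis .
qed

end

section \<open>From the assumptions on the process to the abstract chain\<close>

text \<open>If \<open>mean_dist P\<close> were infinite everywhere, so would be the moment. Hence it
  is finite at some point, by the triangle inequality at every point, and the extended-valued moment
  agrees with the real one.\<close>

lemma mean_dist_square_exp_moment:
  fixes P :: "'b::polish_space measure" and p C :: real
  defines "G \<equiv> \<lambda>y. \<integral>y'. dist y y' \<partial>P"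
  assumes P: "prob_space P" and sets_P [measurable_cong]: "sets P = sets borel"
    and fin: "(\<integral>\<^sup>+ y. (mean_dist P y)\<^sup>2 * ennreal_exp (ennreal_powr (mean_dist P y) p) \<partial>P) \<le> ennreal C"
  shows "integrable P (dist y)"
    and "(\<integral>\<^sup>+ y. ennreal ((G y)\<^sup>2 * exp (G y powr p)) \<partial>P) \<le> ennreal C"
proof -
  interpret P: prob_space P
    by (rule P)
  have "\<exists>z. mean_dist P z \<noteq> \<infinity>"
  proof (rule ccontr)
    assume "\<nexists>z. mean_dist P z \<noteq> \<infinity>"
    then have "(mean_dist P y)\<^sup>2 * ennreal_exp (ennreal_powr (mean_dist P y) p) = \<infinity>" for y
      by (simp add: ennreal_powr_def ennreal_exp_def power2_eq_square ennreal_mult_top)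
    then show False
      using fin P.emeasure_space_1 by (simp add: top_unique)
  qed
  then obtain z where z: "mean_dist P z \<noteq> \<infinity>"
    by blast
  have dist_z: "integrable P (dist z)"
    using z by (intro integrableI_bounded) (auto simp: mean_dist_def less_top)
  have int: "integrable P (dist y)" for y
  proof (rule Bochner_Integration.integrable_bound)
    show "integrable P (\<lambda>y'. dist y z + dist z y')"
      using dist_z by simp
    show "AE y' in P. norm (dist y y') \<le> norm (dist y z + dist z y')"
      by (auto intro: dist_triangle)
  qed measurable
  then show "integrable P (dist y)" .
  have "mean_dist P y = ennreal (G y)" "0 \<le> G y" for y
    unfolding mean_dist_def G_def using int by (auto intro: nn_integral_eq_integral)
  then show "(\<integral>\<^sup>+ y. ennreal ((G y)\<^sup>2 * exp (G y powr p)) \<partial>P) \<le> ennreal C"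
    using fin by (simp add: ennreal_powr_def ennreal_exp_def ennreal_power ennreal_mult)
qed

theorem proposition4p4:
  fixes M :: "'w measure"
    and eps :: "nat \<Rightarrow> 'w \<Rightarrow> 'b::polish_space"
    and x0 :: "int \<Rightarrow> 'a::polish_space"
    and X :: "int \<Rightarrow> 'w \<Rightarrow> 'a"
    and F :: "nat \<Rightarrow> (nat \<Rightarrow> 'a) \<Rightarrow> 'b \<Rightarrow> 'a"
    and a :: "nat \<Rightarrow> real"
    and n :: nat
    and f :: "(nat \<Rightarrow> 'a) \<Rightarrow> real"
    and S :: "'w \<Rightarrow> real"
    and p :: real
    and Kc :: "nat \<Rightarrow> real"
    and K :: real
    and x :: real
  assumes M: "prob_space M"
    and eps_indep: "prob_space.indep_vars M (\<lambda>_. borel) eps {1..}"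
    and F_meas: "\<And>m. m \<ge> 1 \<Longrightarrow>
      (\<lambda>(u, y). F m u y) \<in> borel_measurable (Pi\<^sub>M UNIV (\<lambda>_::nat. borel) \<Otimes>\<^sub>M borel)"
    and X_init: "\<And>i \<omega>. i \<le> 0 \<Longrightarrow> \<omega> \<in> space M \<Longrightarrow> X i \<omega> = x0 i"
    and X_rec: "\<And>m \<omega>. m \<ge> 1 \<Longrightarrow> \<omega> \<in> space M \<Longrightarrow>
      X (int m) \<omega> = F m (past (\<lambda>i. X i \<omega>) (int m)) (eps m \<omega>)"
    and a_nonneg: "\<And>i. i \<ge> 1 \<Longrightarrow> a i \<ge> 0"
    and a_summable: "summable (\<lambda>j. a (Suc j))"
    and a_sum: "(\<Sum>j. a (Suc j)) < 1"
    and contraction: "\<And>m u u'. m \<ge> 1 \<Longrightarrow>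
      (\<integral>\<^sup>+ \<omega>. ennreal (dist (F m u (eps m \<omega>)) (F m u' (eps m \<omega>))) \<partial>M)
        \<le> (\<Sum>j. ennreal (a (Suc j) * dist (u j) (u' j)))"
    and n: "n \<ge> 1"
    and f_lip: "\<And>u u'. u \<in> {1..n} \<rightarrow>\<^sub>E UNIV \<Longrightarrow> u' \<in> {1..n} \<rightarrow>\<^sub>E UNIV \<Longrightarrow>
      \<bar>f u - f u'\<bar> \<le> (\<Sum>i=1..n. dist (u i) (u' i))"
    and S_def: "\<And>\<omega>. S \<omega> = f (\<lambda>i\<in>{1..n}. X (int i) \<omega>)
                  - prob_space.expectation M (\<lambda>\<omega>'. f (\<lambda>i\<in>{1..n}. X (int i) \<omega>'))"
    and F_lip: "\<And>m u y y'. m \<ge> 1 \<Longrightarrow> dist (F m u y) (F m u y') \<le> dist y y'"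
    and p: "0 < p" "p < 1"
    and Kc_pos: "\<And>k. k \<in> {1..n} \<Longrightarrow> Kc k > 0"
    and moment: "\<And>k. k \<in> {1..n} \<Longrightarrow>
      (\<integral>\<^sup>+ \<omega>. (mean_dist (distr M borel (eps k)) (eps k \<omega>))\<^sup>2
             * ennreal_exp (ennreal_powr (mean_dist (distr M borel (eps k)) (eps k \<omega>)) p) \<partial>M)
        \<le> ennreal (Kc k)"
    and K_def: "K = (\<Sum>k=1..n. (acum a (n - k) / acum a (n - 1))\<^sup>2 * Kc k)"
    and K_ge: "K \<ge> 1"
    and x: "x \<ge> 0"
  shows "prob_space.prob M {\<omega> \<in> space M. S \<omega> \<ge> x}
           \<le> 2 * exp (- x\<^sup>2 / (2 * (K * (acum a (n - 1))\<^sup>2 + x powr (2 - p) * acum a (n - 1) powr p)))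
       \<and> prob_space.prob M {\<omega> \<in> space M. - S \<omega> \<ge> x}
           \<le> 2 * exp (- x\<^sup>2 / (2 * (K * (acum a (n - 1))\<^sup>2 + x powr (2 - p) * acum a (n - 1) powr p)))"
proof -
  interpret innovations M borel eps
    using M eps_indep by (auto simp: innovations_def innovations_axioms_def)
  \<comment> \<open>The argument of \<open>f\<close> runs forward in time, a past runs backward:
    entry \<open>n - i\<close> of the past of time \<open>n + 1\<close> is the value at time
    \<open>i\<close>.\<close>
  define g where "g u = f (\<lambda>i\<in>{1..n}. u (n - i))" for u
  define u0 where "u0 = (\<lambda>j. x0 (- int j))"
  have law_moment: "(\<integral>\<^sup>+ y. (mean_dist (law k) y)\<^sup>2 * ennreal_exp (ennreal_powr (mean_dist (law k) y) p) \<partial>law k)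
      \<le> ennreal (Kc k)" if k: "k \<in> {1..n}" for k
  proof -
    have [measurable]: "eps k \<in> measurable M borel"
      using k by (intro measurable_eps) simp
    interpret law: prob_space "law k"
      using k by (intro prob_space_law) simp
    have [measurable]: "mean_dist (law k) \<in> borel_measurable borel"
      unfolding mean_dist_def[abs_def] by measurable
    have [measurable]: "(\<lambda>t. ennreal_powr t p) \<in> borel_measurable borel" "ennreal_exp \<in> borel_measurable borel"
      unfolding ennreal_powr_def[abs_def] ennreal_exp_def[abs_def] by measurable
    have "(\<integral>\<^sup>+ y. (mean_dist (law k) y)\<^sup>2 * ennreal_exp (ennreal_powr (mean_dist (law k) y) p) \<partial>distr M borel (eps k))
        = (\<integral>\<^sup>+ \<omega>. (mean_dist (law k) (eps k \<omega>))\<^sup>2 * ennreal_exp (ennreal_powr (mean_dist (law k) (eps k \<omega>)) p) \<partial>M)"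
      by (subst nn_integral_distr) auto
    then show ?thesis
      using moment[OF k] by (simp add: law_def)
  qed
  note gap = mean_dist_square_exp_moment[OF prob_space_law sets_law law_moment]
  interpret contracting_chain M eps F a n g u0
  proof unfold_locales
    fix m u u' assume m: "1 \<le> (m::nat)"
    have [measurable]: "eps m \<in> measurable M borel"
      by (rule measurable_eps[OF m])
    \<comment> \<open>Yields Borel measurability of \<open>F m w\<close> in the innovation, needed
      to move the contraction from \<open>M\<close> to \<open>law m\<close>.\<close>
    have cont: "continuous_on UNIV (F m w)" for w
      using F_lip[OF m] by (intro lipschitz_on_continuous_on[of 1] lipschitz_onI) auto
    have [measurable]: "F m w \<in> borel_measurable borel" for w
      by (intro borel_measurable_continuous_onI cont)
    show "(\<integral>\<^sup>+ y. ennreal (dist (F m u y) (F m u' y)) \<partial>law m) \<le> (\<Sum>j. ennreal (a (Suc j) * dist (u j) (u' j)))"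
      using contraction[OF m, of u u'] unfolding law_def by (subst nn_integral_distr) auto
  next
    fix u u' :: "nat \<Rightarrow> 'a"
    have "\<bar>g u - g u'\<bar> \<le> (\<Sum>i=1..n. dist ((\<lambda>i\<in>{1..n}. u (n - i)) i) ((\<lambda>i\<in>{1..n}. u' (n - i)) i))"
      unfolding g_def by (rule f_lip) auto
    also have "\<dots> = (\<Sum>i=1..n. dist (u (n - i)) (u' (n - i)))"
      by (intro sum.cong) auto
    also have "\<dots> = (\<Sum>j<n. dist (u j) (u' j))"
      by (rule sum.reindex_bij_witness[of _ "\<lambda>j. n - j" "\<lambda>i. n - i"]) auto
    finally show "\<bar>g u - g u'\<bar> \<le> (\<Sum>j<n. dist (u j) (u' j))" .
  next
    fix m y assume "m \<in> {1..n}"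
    then show "integrable (law m) (dist y)"
      using gap(1)[of m] by simp
  qed (use F_meas a_nonneg F_lip in auto)
  \<comment> \<open>Putting the new value in entry 0 and shifting the others is how
    \<open>past\<close> changes when time advances by one.\<close>
  have state_past: "state m (\<lambda>i. eps i \<omega>) = past (\<lambda>i. X i \<omega>) (int (Suc m))" if \<omega>: "\<omega> \<in> space M" for m \<omega>
  proof (induction m)
    case 0
    then show ?case
      unfolding state.simps unfolding u0_def using X_init[OF _ \<omega>] by (simp add: past_def)
  next
    case (Suc m)
    show ?case
    proof
      fix j
      show "state (Suc m) (\<lambda>i. eps i \<omega>) j = past (\<lambda>i. X i \<omega>) (int (Suc (Suc m))) j"
        using X_rec[of "Suc m", OF _ \<omega>] by (cases j) (simp_all add: Suc past_def algebra_simps)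
    qed
  qed
  have g_state: "g (state n (\<lambda>i. eps i \<omega>)) = f (\<lambda>i\<in>{1..n}. X (int i) \<omega>)" if "\<omega> \<in> space M" for \<omega>
    unfolding g_def state_past[OF that] by (rule arg_cong[where f=f]) (auto simp: past_def of_nat_diff)
  have "expectation (\<lambda>\<omega>. g (state n (\<lambda>i. eps i \<omega>))) = expectation (\<lambda>\<omega>. f (\<lambda>i\<in>{1..n}. X (int i) \<omega>))"
    by (intro Bochner_Integration.integral_cong) (auto simp: g_state)
  then have S: "S \<omega> = g (state n (\<lambda>i. eps i \<omega>)) - expectation (\<lambda>\<omega>. g (state n (\<lambda>i. eps i \<omega>)))"
    if "\<omega> \<in> space M" for \<omega>
    using that by (simp add: S_def g_state)
  have "prob {\<omega> \<in> space M. x \<le> s * S \<omega>}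
      \<le> 2 * exp (- x\<^sup>2 / (2 * (K * (acum a (n - 1))\<^sup>2 + x powr (2 - p) * acum a (n - 1) powr p)))"
    if s: "s = 1 \<or> s = - 1" for s
  proof -
    have "{\<omega> \<in> space M. x \<le> s * S \<omega>}
        = {\<omega> \<in> space M. x \<le> s * (g (state n (\<lambda>i. eps i \<omega>)) - expectation (\<lambda>\<omega>. g (state n (\<lambda>i. eps i \<omega>))))}"
      using S by auto
    also have "prob \<dots> \<le> 2 * exp (- x\<^sup>2 / (2 * (K * (acum a (n - 1))\<^sup>2 + x powr (2 - p) * acum a (n - 1) powr p)))"
    proof (rule chain_deviation[OF s p])
      show "K = (\<Sum>m=1..n. (acum a (n - m) / acum a (n - 1))\<^sup>2 * Kc m)"
        by (rule K_def)
      fix m assume m: "m \<in> {1..n}"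
      show "0 \<le> Kc m"
        using Kc_pos[OF m] by simp
      show "(\<integral>\<^sup>+ y. ennreal ((mean_gap m y)\<^sup>2 * exp (mean_gap m y powr p)) \<partial>law m) \<le> ennreal (Kc m)"
        using gap(2)[of m] m by (simp add: mean_gap_def)
    qed (use K_ge x in auto)
    finally show ?thesis .
  qed
  from this[of 1] this[of "- 1"] show ?thesis
    by simp
qed

end
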